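(* Let $X$ be an infinite dimensional complex topological vector space and $T$ a continuous linear operator on $X$. Then $T$ is $\mathbb{R}_+$-supercyclic if and only if $T$ is supercyclic and either the point spectrum $\sigma_p(T^* )$ of the dual operator $T^*$ is empty, or $\sigma_p(T^* )=\{z\}$, where $z\in\mathbb{C}\setminus\{0\}$ and $z/|z|$ has infinite order in the group $\mathbb{T}$.
   Context: All topological vector spaces are assumed Hausdorff (not necessarily locally convex). $\mathbb{R}_+$ is the set of non-negative reals, $\mathbb{Z}_+$ the set of non-negative integers, $\mathbb{T}=\{z\in\mathbb{C}:|z|=1\}$ (a group under multiplication). $X^*$ is the space of continuous linear functionals on $X$, and $T^*:X^*\to X^*$ is $(T^*f)(x)=f(Tx)$. The point spectrum $\sigma_p(T^* )$ is the set of $z\in\mathbb{C}$ for which there is a non-zero $f\in X^*$ with $T^*f=zf$. $T$ is supercyclic if there is $x\in X$ such that $\{sT^nx:s\in\mathbb{C},\ n\in\mathbb{Z}_+\}$ is dense in $X$; $T$ is $\mathbb{R}_+$-supercyclic if there is $x\in X$ such that $\{sT^nx:s\in\mathbb{R}_+,\ n\in\mathbb{Z}_+\}$ is dense in $X$. *)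

theory Defs
  imports "HOL-Analysis.Analysis" "HOL-Algebra.Multiplicative_Group"
begin

text \<open>
  There is no type class of complex vector spaces in the distribution, so the scalar
  multiplication is an explicit parameter. The additive group and the Hausdorff topology come
  from type classes; local convexity is not assumed.
\<close>

locale complex_tvs = vector_space smul
  for smul :: "complex \<Rightarrow> 'a \<Rightarrow> 'a :: {topological_ab_group_add, t2_space}" +
  assumes continuous_smul: "continuous_on UNIV (\<lambda>p. smul (fst p) (snd p))"

definition infinite_dimensional :: "(complex \<Rightarrow> 'a \<Rightarrow> 'a :: ab_group_add) \<Rightarrow> bool" where
  "infinite_dimensional smul \<longleftrightarrow> \<not> (\<exists>B. finite_dimensional_vector_space smul B)"

definition supercyclic ::
  "(complex \<Rightarrow> 'a \<Rightarrow> 'a :: {topological_space, ab_group_add}) \<Rightarrow> ('a \<Rightarrow> 'a) \<Rightarrow> bool" where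
  "supercyclic smul T \<longleftrightarrow>
     (\<exists>x. closure {smul s ((T ^^ n) x) | s n. True} = UNIV)"

definition Rplus_supercyclic ::
  "(complex \<Rightarrow> 'a \<Rightarrow> 'a :: {topological_space, ab_group_add}) \<Rightarrow> ('a \<Rightarrow> 'a) \<Rightarrow> bool" where
  "Rplus_supercyclic smul T \<longleftrightarrow>
     (\<exists>x. closure {smul (complex_of_real s) ((T ^^ n) x) | s n. 0 \<le> s} = UNIV)"

definition dual_space ::
  "(complex \<Rightarrow> 'a \<Rightarrow> 'a :: {topological_space, ab_group_add}) \<Rightarrow> ('a \<Rightarrow> complex) set" where
  "dual_space smul = {f. Vector_Spaces.linear smul (*) f \<and> continuous_on UNIV f}"

definition dual_operator :: "('a \<Rightarrow> 'a) \<Rightarrow> ('a \<Rightarrow> complex) \<Rightarrow> ('a \<Rightarrow> complex)" where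
  "dual_operator T f = (\<lambda>x. f (T x))"

definition dual_point_spectrum ::
  "(complex \<Rightarrow> 'a \<Rightarrow> 'a :: {topological_space, ab_group_add}) \<Rightarrow> ('a \<Rightarrow> 'a) \<Rightarrow> complex set" where
  "dual_point_spectrum smul T =
     {z. \<exists>f \<in> dual_space smul. f \<noteq> (\<lambda>x. 0) \<and> dual_operator T f = (\<lambda>x. z * f x)}"

definition circle_group :: "complex monoid" where
  "circle_group = \<lparr>carrier = {z. cmod z = 1}, mult = (*), one = 1\<rparr>"

lemma group_circle_group: "group circle_group"
proof (rule groupI)
  fix z assume z: "z \<in> carrier circle_group"
  then have "inverse z * z = 1"
    by (intro left_inverse) (auto simp: circle_group_def)
  with z show "\<exists>y\<in>carrier circle_group. y \<otimes>\<^bsub>circle_group\<^esub> z = \<one>\<^bsub>circle_group\<^esub>"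
    by (intro bexI[of _ "inverse z"]) (auto simp: circle_group_def norm_inverse)
qed (auto simp: circle_group_def norm_mult mult.assoc)

text \<open>\<open>group.ord\<close> is \<open>0\<close> exactly on the elements of infinite order.\<close>

definition infinite_order_in_circle :: "complex \<Rightarrow> bool" where
  "infinite_order_in_circle w \<longleftrightarrow> w \<in> carrier circle_group \<and> group.ord circle_group w = 0"

lemma infinite_order_in_circle_iff:
  "infinite_order_in_circle w \<longleftrightarrow> cmod w = 1 \<and> (\<forall>n::nat. n > 0 \<longrightarrow> w ^ n \<noteq> 1)"
proof -
  have pow: "w [^]\<^bsub>circle_group\<^esub> n = w ^ n" for n :: nat
    by (induction n) (auto simp: circle_group_def nat_pow_def mult.commute)
  have "group.ord circle_group w = 0 \<longleftrightarrow> (\<forall>n::nat. n > 0 \<longrightarrow> w ^ n \<noteq> 1)"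
    if "w \<in> carrier circle_group"
  proof -
    have *: "w ^ n = 1 \<longleftrightarrow> group.ord circle_group w dvd n" for n :: nat
      using group.pow_eq_id[OF group_circle_group that, of n] pow[of n]
      by (simp add: circle_group_def)
    show ?thesis
      unfolding * by (metis dvd_0_left dvd_refl not_gr_zero)
  qed
  then show ?thesis
    by (auto simp: infinite_order_in_circle_def circle_group_def)
qed

end

(* For u, v in X let F(u,v) be the set of unimodular a such that a v lies in the closure of the
   set of all r T^n u with r >= 0. If x is a supercyclic vector, then F(x,x) is a closed
   subsemigroup of the circle, and x is R_+-supercyclic as soon as F(x,x) is the whole circle.
   Otherwise F(x,x) consists of k-th roots of unity for some k >= 1, and f(v) = a^k with a in
   F(x,v) defines a continuous function from the set of supercyclic vectors to the circle
   with f(b v) = b^(-k) f(v) for unimodular b and f(r v) = f(T v) = f(v) for r > 0.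
   A nonzero polynomial p(T) whose roots are not eigenvalues of T^* maps x to a supercyclic vector.
   If T^* has no eigenvalue, then w |-> f(w x + (1 - |w|) T x) extends w |-> w^(-k) from the
   circle to the disc, which is impossible. If z is the only eigenvalue, all p(T) x with
   p(z) = 1 are supercyclic; they form an affine space on which f has a continuous argument. This
   argument grows by a fixed amount c along the map S = T/z, because f(S v) = (z/|z|)^k f(v).
   As S^n x returns close to x for arbitrarily large n, c = 0 and (z/|z|)^k = 1.
   Conversely, if x is R_+-supercyclic and z is an eigenvalue, then applying an eigenfunctional
   to the orbit shows that the numbers r z^n with r >= 0 are dense in the plane, which rules out
   that a power z^n with n > 0 is a nonnegative real. *)
theory Submission
  imports Defs "HOL-Computational_Algebra.Fundamental_Theorem_Algebra"
begin

section \<open>Closed sets given by a compact parameter, and images of dense sets\<close>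

text \<open>Projection along a compact factor is a closed map. This takes the place of extracting
  convergent subsequences of scalars, as the topology on the vector space need not be first
  countable.\<close>

lemma closed_projection_compact:
  fixes h :: "'k::topological_space \<times> 'b::topological_space \<Rightarrow> 'c::topological_space"
  assumes K: "compact K" and h: "continuous_on (K \<times> UNIV) h" and L: "closed L"
  shows "closed {y. \<exists>k\<in>K. h (k, y) \<in> L}"
proof -
  have "closed_map (prod_topology (top_of_set K) (euclidean :: 'b topology)) euclidean snd"
    by (rule Abstract_Topological_Spaces.closed_map_snd) (simp add: K compact_space_subtopology)
  moreover have "prod_topology (top_of_set K) (euclidean :: 'b topology) = top_of_set (K \<times> UNIV)"
    by (metis subtopology_UNIV prod_topology_subtopology_eu)
  moreover have "closedin (top_of_set (K \<times> UNIV)) ((K \<times> UNIV) \<inter> h -` L)"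
    by (rule continuous_closedin_preimage [OF h L])
  ultimately have "closedin euclidean (snd ` ((K \<times> UNIV) \<inter> h -` L))"
    by (simp add: closed_map_def)
  moreover have "snd ` ((K \<times> UNIV) \<inter> h -` L) = {y. \<exists>k\<in>K. h (k, y) \<in> L}"
    by force
  ultimately show ?thesis by simp
qed

lemma closure_image_of_dense:
  assumes "continuous_on UNIV f" "closure S = UNIV"
  shows "closure (f ` S) = closure (range f)"
proof -
  have "f ` closure S \<subseteq> closure (f ` S)"
    using assms by (intro image_closure_subset) (auto intro: closure_subset [THEN subsetD])
  then have "closure (range f) \<subseteq> closure (f ` S)"
    by (simp add: assms closure_minimal)
  moreover have "closure (f ` S) \<subseteq> closure (range f)"
    by (rule closure_mono) auto
  ultimately show ?thesis by simp
qed

section \<open>The circle\<close>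

text \<open>The multiples of \<alpha> advance in steps of length
  \<open>\<bar>\<alpha>\<bar>\<close>, so one of them comes within that distance of a representative
  of the angle \<beta>.\<close>

lemma cis_power_approx:
  fixes \<alpha> \<beta> :: real
  assumes "\<alpha> \<noteq> 0"
  shows "\<exists>n::nat. cmod (cis \<alpha> ^ n - cis \<beta>) \<le> \<bar>\<alpha>\<bar>"
proof -
  obtain m :: nat where m: "m * (2*pi) \<ge> \<bar>\<beta>\<bar>"
    using reals_Archimedean3 [of "2*pi"] less_imp_le by (metis pi_gt_zero mult_pos_pos zero_less_numeral)
  \<comment> \<open>Shifting \<beta> by full turns to the sign of \<alpha> makes the number of steps
    \<open>b / \<alpha>\<close> nonnegative, as needed for a natural exponent.\<close>
  define b where "b = \<beta> + sgn \<alpha> * (m * (2*pi))"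
  have "cis (real m * (2*pi)) = 1"
    using cis_multiple_2pi [of "real m"] by (simp add: mult.commute)
  then have cb: "cis b = cis \<beta>"
    using assms by (simp add: b_def sgn_if flip: cis_mult cis_divide cis_inverse)
  have b: "b / \<alpha> \<ge> 0"
    using m assms by (cases "\<alpha> > 0") (auto simp: b_def divide_simps sgn_if abs_le_iff)
  define n where "n = nat \<lfloor>b / \<alpha>\<rfloor>"
  have n: "real n \<le> b/\<alpha>" "b/\<alpha> < real n + 1"
    using b unfolding n_def by linarith+
  have "\<bar>b/\<alpha> - n\<bar> \<le> 1" using n by linarith
  then have "\<bar>b/\<alpha> - n\<bar> * \<bar>\<alpha>\<bar> \<le> \<bar>\<alpha>\<bar>"
    by (simp add: mult_left_le_one_le)
  moreover have "(b/\<alpha> - n) * \<alpha> = - (n * \<alpha> - b)"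
    using assms by (simp add: left_diff_distrib)
  ultimately have *: "\<bar>n * \<alpha> - b\<bar> \<le> \<bar>\<alpha>\<bar>"
    by (metis abs_minus_cancel abs_mult)
  have "cmod (cis (n * \<alpha>) - cis b) \<le> \<bar>n * \<alpha> - b\<bar>"
  proof -
    have "cmod (cis (n * \<alpha>) - cis b) = cmod (cis b * (cis (n * \<alpha> - b) - 1))"
      by (simp add: right_diff_distrib cis_mult)
    also have "\<dots> = cmod (exp (\<i> * of_real (n * \<alpha> - b)) - 1)"
      by (simp add: norm_mult cis_conv_exp)
    also have "\<dots> \<le> \<bar>n * \<alpha> - b\<bar>"
      using abs_sin_x_le_abs_x [of "(n * \<alpha> - b) / 2"]
      unfolding dist_exp_i_1 by simp
    finally show ?thesis .
  qed
  with * show ?thesis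
    by (intro exI[of _ n]) (simp add: Complex.DeMoivre cb)
qed

text \<open>A closed set missing \<open>v\<close> misses all points within some \<open>e\<close> of
  \<open>v\<close>, and powers of an element with a small nonzero argument would come that close. By
  Dirichlet approximation every element has a power with exponent at most \<open>N\<close> and
  argument below \<open>e\<close>, which must be 1; \<open>fact N\<close> is a multiple of all these
  exponents.\<close>

lemma proper_closed_subsemigroup_circle:
  assumes H: "closed H" "H \<subseteq> sphere 0 1" "H \<noteq> sphere 0 (1::real)"
    and one: "1 \<in> H" and mult: "\<And>a b. a \<in> H \<Longrightarrow> b \<in> H \<Longrightarrow> a * b \<in> (H :: complex set)"
  shows "\<exists>k>0. \<forall>a\<in>H. a ^ k = 1"
proof -
  have pow: "a ^ n \<in> H" if "a \<in> H" for a n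
    by (induction n) (use that one mult in auto)
  obtain v where v: "cmod v = 1" "v \<notin> H"
    using H(2,3) by (metis dist_0_norm mem_sphere subsetI subset_antisym)
  then obtain e where e: "e > 0" "\<And>u. cmod (u - v) < e \<Longrightarrow> u \<notin> H"
    using \<open>closed H\<close> unfolding closed_def open_dist
    by (metis ComplD ComplI dist_norm)
  have cisv: "v = cis (Arg v)"
    using v by (metis cis_Arg sgn_eq norm_zero zero_neq_one div_by_1 of_real_1)
  have gap: "\<alpha> = 0" if "cis \<alpha> \<in> H" "\<bar>\<alpha>\<bar> < e" for \<alpha>
  proof (rule ccontr)
    assume "\<alpha> \<noteq> 0"
    then obtain n where "cmod (cis \<alpha> ^ n - v) \<le> \<bar>\<alpha>\<bar>"
      using cis_power_approx [of \<alpha> "Arg v"] cisv by auto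
    then have "cis \<alpha> ^ n \<notin> H"
      using e(2) that(2) le_less_trans by blast
    with pow [OF that(1)] show False by blast
  qed
  obtain N where N: "real N * e > 2 * pi"
    using reals_Archimedean3 [OF \<open>e > 0\<close>] by blast
  then have "N > 0" using pi_gt_zero by (cases N) auto
  have "a ^ fact N = 1" if a: "a \<in> H" for a
  proof -
    have "cmod a = 1" using H(2) a by auto
    then have cisa: "a = cis (Arg a)"
      by (metis cis_Arg sgn_eq norm_zero zero_neq_one div_by_1 of_real_1)
    obtain h k where k: "0 < k" "k \<le> int N" and hk: "\<bar>of_int k * (Arg a / (2*pi)) - of_int h\<bar> < 1 / N"
      using Dirichlet_approx [OF \<open>N > 0\<close>] by blast
    \<comment> \<open>\<alpha> is an argument of \<open>a ^ k\<close>, reduced by \<open>h\<close>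
      full turns to size below \<open>2 * pi / N\<close>.\<close>
    define \<alpha> where "\<alpha> = of_int k * Arg a - of_int h * (2*pi)"
    have "cis \<alpha> = cis (of_int k * Arg a)"
      using cis_multiple_2pi [of "of_int h"] by (simp add: \<alpha>_def mult.commute flip: cis_divide)
    also have "\<dots> = cis (real (nat k) * Arg a)"
      using k by simp
    also have "\<dots> = cis (Arg a) ^ nat k"
      by (simp only: Complex.DeMoivre)
    also have "\<dots> = a ^ nat k" using cisa by simp
    finally have ak: "cis \<alpha> = a ^ nat k" .
    have "\<alpha> = (2*pi) * (of_int k * (Arg a / (2*pi)) - of_int h)"
      by (simp add: \<alpha>_def field_simps)
    then have "\<bar>\<alpha>\<bar> = (2*pi) * \<bar>of_int k * (Arg a / (2*pi)) - of_int h\<bar>"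
      by (simp add: abs_mult)
    also have "\<dots> < 2*pi * (1/N)"
      using hk by (intro mult_strict_left_mono) auto
    also have "\<dots> < e"
      using N \<open>N > 0\<close> by (simp add: field_simps)
    finally have "\<alpha> = 0"
      using gap pow [OF a] ak by metis
    then have "a ^ nat k = 1" using ak by simp
    moreover have "nat k dvd fact N"
      using k by (intro dvd_fact) auto
    ultimately show ?thesis
      by (metis dvdE power_mult power_one)
  qed
  then show ?thesis
    by (intro exI[of _ "fact N"]) auto
qed

text \<open>On the circle such an \<open>F\<close> would have winding number \<open>- k\<close>,
  while a zero-free map of the disc has winding number 0. The argument reduces this to the absence
  of a retraction of the disc onto its boundary.\<close>

lemma no_disc_extension_of_inverse_power:
  fixes F :: "complex \<Rightarrow> complex"
  assumes F: "continuous_on (cball 0 1) F" "\<And>w. w \<in> cball 0 1 \<Longrightarrow> F w \<noteq> 0"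
    and k: "k > 0" and sph: "\<And>w. cmod w = 1 \<Longrightarrow> F w * w ^ k = 1"
  shows False
proof -
  obtain h where h: "continuous_on (cball 0 1) h" "\<And>w. w \<in> cball 0 1 \<Longrightarrow> F w = exp (h w)"
    using continuous_logarithm_on_cball [OF F] by blast
  \<comment> \<open>\<open>u\<close> is constant on the circle, so solving for \<open>w\<close> gives a retraction of the disc onto it.\<close>
  define u where "u = (\<lambda>w. w * exp (h w / k))"
  have cont: "continuous_on (sphere 0 1) u"
    unfolding u_def using k
    by (intro continuous_intros continuous_on_subset [OF h(1)]) auto
  have uk: "u w ^ k = 1" if "cmod w = 1" for w
  proof -
    have "u w ^ k = w ^ k * exp (h w)"
      using k by (simp add: u_def power_mult_distrib flip: exp_of_nat_mult)
    then show ?thesis using sph [OF that] h(2) [of w] that by (simp add: mult.commute)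
  qed
  have "u constant_on sphere 0 1"
  proof (rule continuous_finite_range_constant [OF _ cont])
    show "connected (sphere (0::complex) 1)"
      by (rule connected_sphere) simp
    have "u ` sphere 0 1 \<subseteq> {z. z ^ k = 1}"
      using uk by auto
    then show "finite (u ` sphere 0 1)"
      using finite_roots_unity [of k] k finite_subset by (metis One_nat_def Suc_leI)
  qed
  then obtain c where c: "\<And>w. cmod w = 1 \<Longrightarrow> u w = c"
    by (auto simp: constant_on_def)
  have c0: "c \<noteq> 0"
    using uk [of 1] c [of 1] k by (auto simp: power_0_left)
  define r where "r = (\<lambda>w. sgn (c * exp (- (h w / k))))"
  have "retraction (cball 0 1) (sphere 0 1) r"
    unfolding retraction_def
  proof (intro conjI ballI)
    show "continuous_on (cball 0 1) r"
      unfolding r_def sgn_div_norm using k c0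
      by (intro continuous_intros h(1)) auto
    show "r \<in> cball 0 1 \<rightarrow> sphere 0 1"
      using c0 by (auto simp: r_def norm_sgn)
    show "r w = w" if "w \<in> sphere 0 1" for w
    proof -
      have "c * exp (- (h w / k)) = w"
        using c [of w] that by (simp add: u_def exp_minus field_simps)
      then show ?thesis using that by (simp add: r_def sgn_eq)
    qed
  qed auto
  then show False
    using no_retraction_cball [of 1 "0::complex"] by (auto simp: retract_of_def)
qed

section \<open>Change of the logarithm along a path\<close>

text \<open>The imaginary part of \<open>w\<close> is the total change of argument of
  \<open>p\<close> over the unit interval. Splitting off the factor \<open>p 0\<close> makes the
  notion insensitive to multiplying \<open>p\<close> by a constant.\<close>

definition log_change :: "(real \<Rightarrow> complex) \<Rightarrow> complex \<Rightarrow> bool" where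
  "log_change p w \<longleftrightarrow>
     (\<exists>l. continuous_on {0..1} l \<and> l 0 = 0 \<and> l 1 = w \<and> (\<forall>t\<in>{0..1}. p t = p 0 * exp (l t)))"

lemma log_change_exists:
  assumes "continuous_on {0..1} p" "\<And>t. t \<in> {0..1} \<Longrightarrow> p t \<noteq> 0"
  shows "\<exists>w. log_change p w"
proof -
  obtain g where g: "continuous_on {0..1} g" "\<And>t. t \<in> {0..1} \<Longrightarrow> p t = exp (g t)"
    using continuous_logarithm_on_contractible
      [OF assms(1) convex_imp_contractible [OF convex_real_interval(5)] assms(2)] by auto
  have "log_change p (g 1 - g 0)"
    unfolding log_change_def
    by (intro exI[of _ "\<lambda>t. g t - g 0"]) (auto intro!: continuous_intros g simp: g(2) exp_diff)
  then show ?thesis by blast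
qed

text \<open>Two lifts differ at each time by a multiple of \<open>2 * pi * \<i>\<close>. Their
  difference is continuous with values at mutual distance at least \<open>2 * pi\<close>, hence
  constant, and it vanishes at time 0.\<close>

lemma log_change_unique:
  assumes "log_change p v" "log_change p w" "p 0 \<noteq> 0"
  shows "v = w"
proof -
  obtain l where l: "continuous_on {0..1} l" "l 0 = 0" "l 1 = v" "\<And>t. t\<in>{0..1} \<Longrightarrow> p t = p 0 * exp (l t)"
    using assms(1) unfolding log_change_def by blast
  obtain m where m: "continuous_on {0..1} m" "m 0 = 0" "m 1 = w" "\<And>t. t\<in>{0..1} \<Longrightarrow> p t = p 0 * exp (m t)"
    using assms(2) unfolding log_change_def by blast
  have per: "\<exists>n::int. l t - m t = of_real (of_int n * (2 * pi)) * \<i>" if "t \<in> {0..1}" for t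
  proof -
    have "exp (l t) = exp (m t)"
      using l(4) [OF that] m(4) [OF that] \<open>p 0 \<noteq> 0\<close> by simp
    then obtain n :: int where "l t = m t + (of_int (2 * n) * pi) * \<i>"
      unfolding exp_eq by blast
    then show ?thesis by (intro exI[of _ n]) simp
  qed
  have "(\<lambda>t. l t - m t) constant_on {0..1}"
  proof (rule continuous_discrete_range_constant)
    fix t :: real assume t: "t \<in> {0..1}"
    have "2 * pi \<le> cmod ((l s - m s) - (l t - m t))"
      if s: "s \<in> {0..1}" "l s - m s \<noteq> l t - m t" for s
    proof -
      obtain a b :: int where a: "l s - m s = of_real (of_int a * (2 * pi)) * \<i>"
        and b: "l t - m t = of_real (of_int b * (2 * pi)) * \<i>"
        using per [OF s(1)] per [OF t] by auto
      have "a \<noteq> b" using s a b by auto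
      have "(l s - m s) - (l t - m t) = of_real (of_int (a - b) * (2 * pi)) * \<i>"
        unfolding a b by (simp add: left_diff_distrib)
      then have "cmod ((l s - m s) - (l t - m t)) = \<bar>of_int (a - b)\<bar> * (2 * pi)"
        by (simp only: norm_mult norm_of_real norm_ii abs_mult) simp
      moreover have "1 \<le> \<bar>of_int (a - b) :: real\<bar>"
        using \<open>a \<noteq> b\<close> by linarith
      ultimately show ?thesis
        using mult_right_mono [of 1 "\<bar>of_int (a - b)\<bar>" "2 * pi"] pi_ge_zero by linarith
    qed
    then show "\<exists>e>0. \<forall>s. s \<in> {0..1} \<and> l s - m s \<noteq> l t - m t \<longrightarrow> e \<le> norm ((l s - m s) - (l t - m t))"
      by (intro exI[of _ "2*pi"]) simp
  qed (intro continuous_intros l(1) m(1) connected_Icc)+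
  then have "l 1 - m 1 = l 0 - m 0"
    by (auto simp: constant_on_def)
  with l(2,3) m(2,3) show ?thesis by simp
qed

text \<open>A zero-free \<open>Q\<close> has a logarithm on the contractible plane, and the change
  along each edge of the triangle is the difference of its values at the two ends.\<close>

lemma log_change_triangle:
  fixes Q :: "real \<times> real \<Rightarrow> complex"
  assumes Q: "continuous_on UNIV Q" "\<And>z. Q z \<noteq> 0"
    and u: "log_change (\<lambda>t. Q (t, 0)) u" and v: "log_change (\<lambda>t. Q (1 - t, t)) v"
  shows "log_change (\<lambda>t. Q (0, t)) (u + v)"
proof -
  obtain L where L: "continuous_on UNIV L" "\<And>z. Q z = exp (L z)"
    using continuous_logarithm_on_contractible
      [OF Q(1) convex_imp_contractible [OF convex_UNIV] Q(2)] by auto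
  have edge: "log_change (\<lambda>t. Q (e t)) (L (e 1) - L (e 0))" if "continuous_on {0..1} e" for e
  proof -
    have "continuous_on {0..1} (\<lambda>t. L (e t))"
      by (rule continuous_on_compose2 [OF L(1) that]) simp
    then show ?thesis
      unfolding log_change_def
      by (intro exI[of _ "\<lambda>t. L (e t) - L (e 0)"]) (auto intro!: continuous_intros simp: L(2) exp_diff)
  qed
  have "log_change (\<lambda>t. Q (t, 0)) (L (1, 0) - L (0, 0))"
    by (rule edge) (intro continuous_intros)
  then have "u = L (1, 0) - L (0, 0)"
    using log_change_unique [OF u] Q(2) by blast
  moreover have "log_change (\<lambda>t. Q (1 - t, t)) (L (1 - 1, 1) - L (1 - 0, 0))"
    by (rule edge) (intro continuous_intros)
  then have "v = L (0, 1) - L (1, 0)"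
    using log_change_unique [OF v] Q(2) by simp
  moreover have "log_change (\<lambda>t. Q (0, t)) (L (0, 1) - L (0, 0))"
    by (rule edge) (intro continuous_intros)
  ultimately show ?thesis by simp
qed

lemma log_change_scale: "log_change p w \<Longrightarrow> log_change (\<lambda>t. c * p t) w"
  unfolding log_change_def by (auto simp: mult.assoc)

lemma log_change_endpoint: "log_change p w \<Longrightarrow> p 1 = p 0 * exp w"
  unfolding log_change_def by (metis atLeastAtMost_iff order_refl zero_le_one)

text \<open>To reach absolute value \<open>pi / 2\<close>, the argument would have to take it at
  some time, and there the real part of \<open>p\<close> would be 0.\<close>

lemma log_change_halfplane:
  assumes "log_change p w" "p 0 = 1" "\<And>t. t \<in> {0..1} \<Longrightarrow> Re (p t) > 0"
  shows "\<bar>Im w\<bar> < pi / 2"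
proof (rule ccontr)
  assume *: "\<not> ?thesis"
  obtain l where l: "continuous_on {0..1} l" "l 0 = 0" "l 1 = w" "\<And>t. t\<in>{0..1} \<Longrightarrow> p t = exp (l t)"
    using assms unfolding log_change_def by auto
  have "\<exists>t\<ge>0. t \<le> 1 \<and> \<bar>Im (l t)\<bar> = pi / 2"
    by (rule IVT') (use * l in \<open>auto intro!: continuous_intros\<close>)
  then obtain t where t: "t \<in> {0..1}" "\<bar>Im (l t)\<bar> = pi / 2"
    by auto
  then have "cos (Im (l t)) = 0"
    by (metis cos_abs_real cos_pi_half)
  then show False
    using assms(3) [OF t(1)] l(4) [OF t(1)] by (simp add: Re_exp)
qed

section \<open>Closed hyperplanes of topological vector spaces\<close>

lemma (in complex_tvs) continuous_on_smul [continuous_intros]: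
  assumes "continuous_on S f" "continuous_on S g"
  shows "continuous_on S (\<lambda>x. smul (f x) (g x))"
  using continuous_on_compose2 [OF continuous_smul continuous_on_Pair [OF assms]] by simp

lemma (in complex_tvs) closed_scalar_preimage:
  assumes "compact K" "closed C"
  shows "closed {v. \<exists>a\<in>K. smul a v \<in> C}"
  using closed_projection_compact [OF assms(1) _ assms(2), of "\<lambda>p. smul (fst p) (snd p)"]
  by (simp add: continuous_on_subset [OF continuous_smul])

lemma (in complex_tvs) dual_linear:
  assumes "\<phi> \<in> dual_space smul"
  shows "\<phi> (u + v) = \<phi> u + \<phi> v" "\<phi> (u - v) = \<phi> u - \<phi> v" "\<phi> (smul c v) = c * \<phi> v" "\<phi> 0 = 0"
proof -
  interpret \<phi>: Vector_Spaces.linear smul "(*)" \<phi>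
    using assms by (simp add: dual_space_def)
  show "\<phi> (u + v) = \<phi> u + \<phi> v" "\<phi> (u - v) = \<phi> u - \<phi> v" "\<phi> (smul c v) = c * \<phi> v" "\<phi> 0 = 0"
    by (rule \<phi>.add \<phi>.diff \<phi>.scale \<phi>.zero)+
qed

lemma (in complex_tvs) subspace_closure:
  assumes "subspace S"
  shows "subspace (closure S)"
proof (rule subspaceI)
  show "0 \<in> closure S"
    using assms closure_subset subspace_0 by blast
  show "u + v \<in> closure S" if "u \<in> closure S" "v \<in> closure S" for u v
  proof -
    have "(\<lambda>p. fst p + snd p) ` closure (S \<times> S) \<subseteq> closure S"
      by (intro image_closure_subset continuous_intros)
        (use assms closure_subset subspace_add in \<open>auto intro!: closure_subset [THEN subsetD]\<close>)
    then show ?thesis using that by (force simp: closure_Times)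
  qed
  show "smul c u \<in> closure S" if "u \<in> closure S" for c u
  proof -
    have "smul c ` closure S \<subseteq> closure S"
      by (intro image_closure_subset continuous_intros)
        (use assms subspace_scale in \<open>auto intro!: closure_subset [THEN subsetD]\<close>)
    then show ?thesis using that by auto
  qed
qed

text \<open>The coefficient \<open>c\<close> ranges over a noncompact set. For large
  \<open>c\<close>, dividing by it replaces the condition by one on \<open>d = 1 / c\<close> in the
  unit disc; conversely \<open>d = 0\<close> cannot occur, since \<open>x\<close> is not in
  \<open>L\<close>.\<close>

lemma (in complex_tvs) closed_line_plus_subspace:
  assumes L: "subspace L" "closed L" and x: "x \<notin> L"
  shows "closed {v. \<exists>c. v - smul c x \<in> L}" (is "closed ?M")
proof -
  have "closed {v. \<exists>c\<in>cball 0 1. v - smul c x \<in> L}" (is "closed ?A")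
    using closed_projection_compact [of "cball (0::complex) 1" "\<lambda>p. snd p - smul (fst p) x" L] L(2)
    by (simp add: continuous_intros)
  moreover have "closed {v. \<exists>d\<in>cball 0 1. smul d v - x \<in> L}" (is "closed ?B")
    using closed_projection_compact [of "cball (0::complex) 1" "\<lambda>p. smul (fst p) (snd p) - x" L] L(2)
    by (simp add: continuous_intros)
  moreover have "?M = ?A \<union> ?B"
  proof (intro equalityI subsetI)
    fix v assume "v \<in> ?M"
    then obtain c where c: "v - smul c x \<in> L" by blast
    show "v \<in> ?A \<union> ?B"
    proof (cases "cmod c \<le> 1")
      case True
      with c show ?thesis by auto
    next
      case False
      have "smul (1/c) (v - smul c x) \<in> L"
        using L(1) c subspace_scale by blast
      then have "smul (1/c) v - x \<in> L"
        using False by (auto simp: scale_right_diff_distrib split: if_splits)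
      moreover have "1/c \<in> cball 0 1"
        using False by (auto simp: norm_divide divide_simps)
      ultimately show ?thesis by blast
    qed
  next
    fix v assume "v \<in> ?A \<union> ?B"
    then show "v \<in> ?M"
    proof
      assume "v \<in> ?B"
      then obtain d where d: "smul d v - x \<in> L" by blast
      have "d \<noteq> 0"
        using d x L(1) subspace_neg [of L "- x"] by auto
      have "smul (1/d) (smul d v - x) \<in> L"
        using L(1) d subspace_scale by blast
      then have "v - smul (1/d) x \<in> L"
        using \<open>d \<noteq> 0\<close> by (simp add: scale_right_diff_distrib)
      then show ?thesis by blast
    qed auto
  qed
  ultimately show ?thesis by (simp add: closed_Un)
qed

lemma (in complex_tvs) dual_of_closed_hyperplane:
  assumes L: "subspace L" "closed L" and x: "x \<notin> L" and total: "\<And>v. \<exists>c. v - smul c x \<in> L"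
  shows "\<exists>\<phi>\<in>dual_space smul. \<phi> x = 1 \<and> (\<forall>v\<in>L. \<phi> v = 0)"
proof -
  define \<phi> where "\<phi> v = (SOME c. v - smul c x \<in> L)" for v
  have mem: "v - smul (\<phi> v) x \<in> L" for v
    unfolding \<phi>_def by (rule someI_ex) (rule total)
  have eqI: "\<phi> v = c" if c: "v - smul c x \<in> L" for v c
  proof (rule ccontr)
    assume ne: "\<phi> v \<noteq> c"
    have "(v - smul c x) - (v - smul (\<phi> v) x) \<in> L"
      using L(1) c mem subspace_diff by blast
    then have "smul (\<phi> v - c) x \<in> L"
      by (simp add: scale_left_diff_distrib)
    then have "smul (1 / (\<phi> v - c)) (smul (\<phi> v - c) x) \<in> L"
      using L(1) subspace_scale by blast
    with ne x show False by simp
  qed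
  have add: "\<phi> (u + v) = \<phi> u + \<phi> v" for u v
  proof (rule eqI)
    have "(u - smul (\<phi> u) x) + (v - smul (\<phi> v) x) \<in> L"
      using L(1) mem subspace_add by blast
    then show "u + v - smul (\<phi> u + \<phi> v) x \<in> L"
      by (simp add: scale_left_distrib algebra_simps)
  qed
  have scale: "\<phi> (smul c v) = c * \<phi> v" for c v
  proof (rule eqI)
    have "smul c (v - smul (\<phi> v) x) \<in> L"
      using L(1) mem subspace_scale by blast
    then show "smul c v - smul (c * \<phi> v) x \<in> L"
      by (simp add: scale_right_diff_distrib)
  qed
  have lin: "Vector_Spaces.linear smul (*) \<phi>"
    by unfold_locales (auto simp: add scale algebra_simps)
  interpret \<phi>: Vector_Spaces.linear smul "(*)" \<phi> by (rule lin)
  have "closed {v. \<exists>d\<in>cball 0 1. smul d v - x \<in> L}"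
    using closed_projection_compact [of "cball (0::complex) 1" "\<lambda>p. smul (fst p) (snd p) - x" L] L(2)
    by (simp add: continuous_intros)
  \<comment> \<open>The scalar \<open>d = 1 / \<phi> v\<close> moves \<open>v\<close> into the coset
    of \<open>x\<close>, and it lies in the compact disc exactly when \<phi> is at least 1 in
    modulus. So this set is open, and translating and scaling it gives continuity
    everywhere.\<close>
  moreover have "{v. cmod (\<phi> v) < 1} = - {v. \<exists>d\<in>cball 0 1. smul d v - x \<in> L}"
  proof -
    have "cmod (\<phi> v) \<ge> 1 \<longleftrightarrow> (\<exists>d\<in>cball 0 1. smul d v - x \<in> L)" for v
    proof
      assume "cmod (\<phi> v) \<ge> 1"
      then have nz: "\<phi> v \<noteq> 0" and b: "1 / \<phi> v \<in> cball 0 1"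
        by (auto simp: norm_divide divide_simps)
      have "smul (1 / \<phi> v) (v - smul (\<phi> v) x) \<in> L"
        using L(1) mem subspace_scale by blast
      with nz have "smul (1 / \<phi> v) v - x \<in> L"
        by (simp add: scale_right_diff_distrib)
      with b show "\<exists>d\<in>cball 0 1. smul d v - x \<in> L" by blast
    next
      assume "\<exists>d\<in>cball 0 1. smul d v - x \<in> L"
      then obtain d where d: "cmod d \<le> 1" "smul d v - smul 1 x \<in> L" by auto
      have "d * \<phi> v = 1"
        using eqI [OF d(2)] scale by simp
      then have "cmod d * cmod (\<phi> v) = 1"
        by (metis norm_mult norm_one)
      with d(1) show "cmod (\<phi> v) \<ge> 1"
        by (metis mult_left_le_one_le norm_ge_zero)
    qed
    then show ?thesis by (auto simp: not_le [symmetric])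
  qed
  ultimately have op: "open {v. cmod (\<phi> v) < 1}"
    by (simp add: open_Compl)
  have "continuous_on UNIV \<phi>"
    unfolding continuous_on_topological
  proof (intro ballI allI impI)
    fix u B assume B: "open B" "\<phi> u \<in> B"
    then obtain e where e: "e > 0" "ball (\<phi> u) e \<subseteq> B"
      by (meson open_contains_ball)
    define h where "h v = smul (1 / of_real e) (v - u)" for v
    have "continuous_on UNIV h"
      unfolding h_def by (intro continuous_intros)
    then have "open (h -` {v. cmod (\<phi> v) < 1})"
      by (intro open_vimage op)
    moreover have "u \<in> h -` {v. cmod (\<phi> v) < 1}"
      by (simp add: h_def \<phi>.zero)
    moreover have "\<phi> v \<in> B" if "v \<in> h -` {v. cmod (\<phi> v) < 1}" for v
    proof -
      have "cmod (\<phi> v - \<phi> u) < e"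
        using that e(1) by (simp add: h_def scale \<phi>.diff norm_divide norm_mult)
      with e(2) show ?thesis by (auto simp: dist_norm norm_minus_commute)
    qed
    ultimately show "\<exists>A. open A \<and> u \<in> A \<and> (\<forall>y\<in>UNIV. y \<in> A \<longrightarrow> \<phi> y \<in> B)"
      by blast
  qed
  with lin have "\<phi> \<in> dual_space smul"
    by (simp add: dual_space_def)
  moreover have "\<phi> x = 1"
    using L(1) subspace_0 by (intro eqI) simp
  moreover have "\<phi> v = 0" if "v \<in> L" for v
    using that by (intro eqI) simp
  ultimately show ?thesis by blast
qed

section \<open>Supercyclic vectors and polynomials of an operator\<close>

locale continuous_operator = complex_tvs smul + T: Vector_Spaces.linear smul smul T
  for smul :: "complex \<Rightarrow> 'a \<Rightarrow> 'a :: {topological_ab_group_add, t2_space}" and T +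
  assumes continuous_T: "continuous_on UNIV T"
begin

lemma continuous_on_T [continuous_intros]: "continuous_on S f \<Longrightarrow> continuous_on S (\<lambda>v. T (f v))"
  using continuous_on_compose2 [OF continuous_T] by blast

lemma funpow_smul: "(T ^^ n) (smul c v) = smul c ((T ^^ n) v)"
  by (induction n) (simp_all add: T.scale)

lemma continuous_on_funpow [continuous_intros]:
  "continuous_on S f \<Longrightarrow> continuous_on S (\<lambda>v. (T ^^ n) (f v))"
  by (induction n) (simp_all add: continuous_on_T)

lemma dual_eigen_funpow:
  assumes "\<phi> \<in> dual_space smul" "\<And>v. \<phi> (T v) = z * \<phi> v"
  shows "\<phi> ((T ^^ n) v) = z ^ n * \<phi> v"
  by (induction n) (simp_all add: assms)

text \<open>This is the vector p(T) v, computed by the Horner scheme.\<close>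

definition peval :: "complex poly \<Rightarrow> 'a \<Rightarrow> 'a" where
  "peval p v = fold_coeffs (\<lambda>a r. smul a v + T r) p 0"

lemma peval_0 [simp]: "peval 0 v = 0"
  by (simp add: peval_def)

lemma peval_pCons [simp]: "peval (pCons a p) v = smul a v + T (peval p v)"
  by (cases "p = 0"; cases "a = 0")
    (auto simp: peval_def T.zero fold_coeffs_pCons_coeff_not_0_eq fold_coeffs_pCons_not_0_0_eq)

lemma peval_1 [simp]: "peval 1 v = v"
  by (simp add: one_pCons T.zero)

lemma peval_add: "peval (p + q) v = peval p v + peval q v"
  by (induction p q rule: poly_induct2) (simp_all add: T.add algebra_simps)

lemma peval_smult: "peval (Polynomial.smult c p) v = smul c (peval p v)"
  by (induction p) (simp_all add: T.scale algebra_simps)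

lemma peval_diff: "peval (p - q) v = peval p v - peval q v"
  using peval_add [of "p - q" q v] by simp

lemma peval_linear_mult: "peval ([:- c, 1:] * p) v = T (peval p v) - smul c (peval p v)"
  by (simp add: peval_diff peval_smult)

lemma peval_T: "peval p (T v) = T (peval p v)"
  by (induction p) (simp_all add: T.zero T.add T.scale)

lemma peval_smul: "peval p (smul c v) = smul c (peval p v)"
  by (induction p) (simp_all add: T.scale algebra_simps)

lemma peval_funpow: "peval p ((T ^^ n) v) = (T ^^ n) (peval p v)"
  by (induction n) (simp_all add: peval_T)

lemma continuous_on_peval [continuous_intros]:
  "continuous_on S f \<Longrightarrow> continuous_on S (\<lambda>v. peval p (f v))"
  by (induction p) (simp_all add: continuous_intros)

text \<open>Over the complex numbers p(T) is a nonzero multiple of a product of factors T - \<mu>,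
  and a composition of continuous maps with dense range has dense range.\<close>

lemma peval_dense_range:
  assumes "p \<noteq> 0" "\<And>\<mu>. poly p \<mu> = 0 \<Longrightarrow> closure (range (\<lambda>v. T v - smul \<mu> v)) = UNIV"
  shows "closure (range (peval p)) = UNIV"
  using assms
proof (induction "degree p" arbitrary: p)
  case 0
  then obtain c where c: "p = [:c:]" "c \<noteq> 0"
    by (metis degree_0_id degree_eq_zeroE pCons_0_0)
  have "v \<in> range (peval p)" for v
    using c by (intro image_eqI [of _ _ "smul (1/c) v"]) (simp_all add: T.zero)
  then show ?case by (metis UNIV_eq_I closure_UNIV)
next
  case (Suc n)
  obtain \<mu> where \<mu>: "poly p \<mu> = 0"
    using alg_closed_imp_poly_has_root [of p] Suc.hyps(2) by auto
  then obtain q where q: "p = [:- \<mu>, 1:] * q"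
    by (metis dvdE poly_eq_0_iff_dvd)
  have "q \<noteq> 0" using q Suc.prems(1) by auto
  have "degree p = Suc (degree q)"
    unfolding q using \<open>q \<noteq> 0\<close> by (subst degree_mult_eq) auto
  then have "closure (range (peval q)) = UNIV"
    using Suc.hyps \<open>q \<noteq> 0\<close> Suc.prems(2) q by (metis mult_zero_right nat.inject poly_mult)
  then have "closure ((\<lambda>v. T v - smul \<mu> v) ` range (peval q)) = UNIV"
    using closure_image_of_dense [of "\<lambda>v. T v - smul \<mu> v" "range (peval q)"] Suc.prems(2) [OF \<mu>]
    by (simp add: continuous_intros continuous_T)
  moreover have "(\<lambda>v. T v - smul \<mu> v) ` range (peval q) = range (peval p)"
    unfolding q image_image peval_linear_mult ..
  ultimately show ?case by simp
qed

definition supercyclic_vector :: "'a \<Rightarrow> bool" where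
  "supercyclic_vector v \<longleftrightarrow> closure {smul s ((T ^^ n) v) | s n. True} = UNIV"

text \<open>As p(T) commutes with \<open>T\<close> and with scalars, it carries the scaled orbit of
  \<open>v\<close> onto that of p(T) v, and a continuous map with dense range preserves
  density.\<close>

lemma supercyclic_vector_peval:
  assumes "supercyclic_vector v" "closure (range (peval p)) = UNIV"
  shows "supercyclic_vector (peval p v)"
proof -
  have "continuous_on UNIV (peval p)"
    using continuous_on_peval [OF continuous_on_id] by simp
  then have "closure (peval p ` {smul s ((T ^^ n) v) | s n. True}) = UNIV"
    using closure_image_of_dense [of "peval p" "{smul s ((T ^^ n) v) | s n. True}"] assms
    by (simp add: supercyclic_vector_def)
  moreover have "peval p ` {smul s ((T ^^ n) v) | s n. True} = {smul s ((T ^^ n) (peval p v)) | s n. True}"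
    by (auto simp: peval_smul peval_funpow image_iff) (metis peval_smul peval_funpow)+
  ultimately show ?thesis
    by (simp add: supercyclic_vector_def)
qed

text \<open>
  Without local convexity the Hahn-Banach theorem is not available. Instead, modulo the closure
  \<open>L\<close> of the range of \<open>T - \<mu>\<close> the orbit of a supercyclic vector stays on a line, so \<open>L\<close> is a
  closed hyperplane or the whole space.
\<close>

lemma dense_range_if_not_eigenvalue:
  assumes x: "supercyclic_vector x" and \<mu>: "\<mu> \<notin> dual_point_spectrum smul T"
  shows "closure (range (\<lambda>v. T v - smul \<mu> v)) = UNIV"
proof (rule ccontr)
  define R where "R = range (\<lambda>v. T v - smul \<mu> v)"
  define L where "L = closure R"
  assume "\<not> ?thesis"
  then have LU: "L \<noteq> UNIV" by (simp add: L_def R_def)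
  have R: "subspace R"
  proof (rule subspaceI)
    show "0 \<in> R"
      unfolding R_def by (rule range_eqI [of _ _ 0]) (simp add: T.zero)
    show "u + v \<in> R" if uv: "u \<in> R" "v \<in> R" for u v
    proof -
      obtain a b where ab: "u = T a - smul \<mu> a" "v = T b - smul \<mu> b"
        using uv unfolding R_def by blast
      show ?thesis
        unfolding R_def ab by (intro range_eqI [of _ _ "a + b"]) (simp add: T.add algebra_simps)
    qed
    show "smul c u \<in> R" if u: "u \<in> R" for c u
    proof -
      obtain a where a: "u = T a - smul \<mu> a"
        using u unfolding R_def by blast
      show ?thesis
        unfolding R_def a by (intro range_eqI [of _ _ "smul c a"]) (simp add: T.scale algebra_simps)
    qed
  qed
  then have L: "subspace L" "closed L"
    by (simp_all add: L_def subspace_closure)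
  have TL: "T v - smul \<mu> v \<in> L" for v
    unfolding L_def R_def by (rule closure_subset [THEN subsetD]) (rule rangeI)
  \<comment> \<open>Modulo \<open>L\<close> the operator acts as multiplication by \<mu>, so the
    whole orbit stays on the line through \<open>x\<close>.\<close>
  have pow: "(T ^^ n) x - smul (\<mu> ^ n) x \<in> L" for n
  proof (induction n)
    case 0
    then show ?case using L(1) subspace_0 by simp
  next
    case (Suc n)
    have "(T ((T ^^ n) x) - smul \<mu> ((T ^^ n) x)) + smul \<mu> ((T ^^ n) x - smul (\<mu> ^ n) x) \<in> L"
      using L(1) Suc TL subspace_add subspace_scale by blast
    then show ?case by (simp add: algebra_simps)
  qed
  have orbit: "smul s ((T ^^ n) x) - smul (s * \<mu> ^ n) x \<in> L" for s n
    using subspace_scale [OF L(1) pow, of s n] by (simp add: algebra_simps)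
  have "x \<notin> L"
  proof
    assume "x \<in> L"
    then have "smul s ((T ^^ n) x) \<in> L" for s n
      using subspace_add [OF L(1) orbit subspace_scale [OF L(1), of x "s * \<mu> ^ n"], of s n] by simp
    then have "{smul s ((T ^^ n) x) | s n. True} \<subseteq> L"
      by blast
    then show False
      using x LU L(2) closure_minimal unfolding supercyclic_vector_def by blast
  qed
  have total: "\<exists>c. v - smul c x \<in> L" for v
  proof -
    have "{smul s ((T ^^ n) x) | s n. True} \<subseteq> {v. \<exists>c. v - smul c x \<in> L}"
      using orbit by blast
    then have "closure {smul s ((T ^^ n) x) | s n. True} \<subseteq> {v. \<exists>c. v - smul c x \<in> L}"
      using closed_line_plus_subspace [OF L \<open>x \<notin> L\<close>] closure_minimal by blast
    then show ?thesis using x unfolding supercyclic_vector_def by blast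
  qed
  obtain \<phi> where \<phi>: "\<phi> \<in> dual_space smul" "\<phi> x = 1" "\<And>v. v \<in> L \<Longrightarrow> \<phi> v = 0"
    using dual_of_closed_hyperplane [OF L \<open>x \<notin> L\<close> total] by blast
  have "\<phi> (T v) = \<mu> * \<phi> v" for v
    using \<phi>(3) [OF TL [of v]] by (simp add: dual_linear [OF \<phi>(1)])
  then have "\<mu> \<in> dual_point_spectrum smul T"
    unfolding dual_point_spectrum_def dual_operator_def
    using \<phi> by (intro CollectI bexI [of _ \<phi>]) (auto dest: fun_cong [of _ _ x])
  with \<mu> show False by blast
qed

section \<open>Phases\<close>

text \<open>A vector is R_+-supercyclic exactly when this closed set is the whole space.\<close>

definition rays :: "'a \<Rightarrow> 'a set" where
  "rays v = closure {smul (of_real s) ((T ^^ n) v) | s n. 0 \<le> s}"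

lemma closed_rays: "closed (rays v)"
  by (simp add: rays_def)

lemma rays_orbit: "0 \<le> s \<Longrightarrow> smul (of_real s) ((T ^^ n) v) \<in> rays v"
  unfolding rays_def by (rule closure_subset [THEN subsetD]) blast

lemma rays_self: "v \<in> rays v"
  using rays_orbit [of 1 0] by simp

lemma rays_orbit_of_mem:
  assumes u: "u \<in> rays v" and r: "0 \<le> r"
  shows "smul (of_real r) ((T ^^ m) u) \<in> rays v"
proof -
  have "(\<lambda>w. smul (of_real r) ((T ^^ m) w)) ` rays v \<subseteq> rays v"
    unfolding rays_def
  proof (rule image_closure_subset)
    show "(\<lambda>w. smul (of_real r) ((T ^^ m) w)) ` {smul (of_real s) ((T ^^ n) v) | s n. 0 \<le> s}
      \<subseteq> closure {smul (of_real s) ((T ^^ n) v) | s n. 0 \<le> s}"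
    proof (clarify)
      fix s :: real and n assume "0 \<le> s"
      have "smul (of_real r) ((T ^^ m) (smul (of_real s) ((T ^^ n) v)))
          = smul (of_real (r * s)) ((T ^^ (m + n)) v)"
        by (simp add: funpow_smul funpow_add)
      then show "smul (of_real r) ((T ^^ m) (smul (of_real s) ((T ^^ n) v)))
          \<in> closure {smul (of_real s) ((T ^^ n) v) | s n. 0 \<le> s}"
        using rays_orbit [of "r * s" "m + n" v] r \<open>0 \<le> s\<close> by (simp add: rays_def)
    qed
  qed (auto intro!: continuous_intros)
  with u show ?thesis by blast
qed

lemma rays_trans:
  assumes "u \<in> rays v"
  shows "rays u \<subseteq> rays v"
  unfolding rays_def [of u]
  by (rule closure_minimal) (use rays_orbit_of_mem [OF assms] closed_rays in auto)

lemma rays_smul: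
  assumes "u \<in> rays v"
  shows "smul c u \<in> rays (smul c v)"
proof -
  have "smul c ` rays v \<subseteq> rays (smul c v)"
    unfolding rays_def [of v]
  proof (rule image_closure_subset)
    show "smul c ` {smul (of_real s) ((T ^^ n) v) | s n. 0 \<le> s} \<subseteq> rays (smul c v)"
    proof clarify
      fix s :: real and n assume "0 \<le> s"
      then show "smul c (smul (of_real s) ((T ^^ n) v)) \<in> rays (smul c v)"
        using rays_orbit [of s n "smul c v"] by (simp add: funpow_smul mult.commute)
    qed
  qed (auto intro!: continuous_intros closed_rays)
  with assms show ?thesis by blast
qed

text \<open>These are the sets F(u,v) of the opening comment.\<close>

definition phases :: "'a \<Rightarrow> 'a \<Rightarrow> complex set" where
  "phases u v = {a. cmod a = 1 \<and> smul a v \<in> rays u}"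

lemma phases_mult:
  assumes "a \<in> phases u v" "b \<in> phases v w"
  shows "a * b \<in> phases u w"
proof -
  have "smul a (smul b w) \<in> rays (smul a v)"
    using assms(2) rays_smul [of "smul b w" v a] by (simp only: phases_def mem_Collect_eq)
  then have "smul a (smul b w) \<in> rays u"
    using assms rays_trans unfolding phases_def by blast
  with assms show ?thesis by (simp add: phases_def norm_mult)
qed

text \<open>Each multiple \<open>s\<close> of an orbit point is rotated into \<open>rays u\<close>
  by the inverse of \<open>sgn s\<close>. Since the circle is compact, having such a rotation is a
  closed condition, so it passes to the closure of the orbit multiples.\<close>

lemma phases_nonempty:
  assumes "supercyclic_vector u"
  shows "\<exists>a. a \<in> phases u v"
proof -
  have "{smul s ((T ^^ n) u) | s n. True} \<subseteq> {w. \<exists>a\<in>sphere 0 1. smul a w \<in> rays u}"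
  proof clarify
    fix s n
    show "\<exists>a\<in>sphere 0 1. smul a (smul s ((T ^^ n) u)) \<in> rays u"
    proof (cases "s = 0")
      case True
      then show ?thesis
        using rays_orbit [of 0 n u] by (intro bexI [of _ 1]) auto
    next
      case False
      have "inverse (sgn s) * s = of_real (cmod s)"
        using False by (simp add: sgn_eq)
      then have "smul (inverse (sgn s)) (smul s ((T ^^ n) u)) \<in> rays u"
        using rays_orbit [of "cmod s" n u] by simp
      then show ?thesis
        using False by (intro bexI [of _ "inverse (sgn s)"]) (auto simp: norm_inverse norm_sgn)
    qed
  qed
  then have "closure {smul s ((T ^^ n) u) | s n. True} \<subseteq> {w. \<exists>a\<in>sphere 0 1. smul a w \<in> rays u}"
    by (rule closure_minimal) (intro closed_scalar_preimage closed_rays compact_sphere)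
  then show ?thesis
    using assms unfolding supercyclic_vector_def phases_def by fastforce
qed

text \<open>If all phases occur from \<open>x\<close> to itself, any phase from \<open>x\<close> to
  \<open>v\<close> can be cancelled by its inverse, leaving the phase 1.\<close>

lemma rays_eq_UNIV_iff:
  assumes "supercyclic_vector x"
  shows "rays x = UNIV \<longleftrightarrow> phases x x = sphere 0 1"
proof
  assume full: "phases x x = sphere 0 1"
  have "v \<in> rays x" for v
  proof -
    obtain a where a: "a \<in> phases x v"
      using phases_nonempty [OF assms] by blast
    then have "inverse a \<in> phases x x"
      unfolding full by (auto simp: phases_def norm_inverse)
    then have "inverse a * a \<in> phases x v"
      using a phases_mult by blast
    moreover have "a \<noteq> 0" using a by (auto simp: phases_def)
    ultimately show ?thesis by (simp add: phases_def)
  qed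
  then show "rays x = UNIV" by blast
qed (auto simp: phases_def)

lemma closed_phases: "closed (phases u v)"
proof -
  have "phases u v = sphere 0 1 \<inter> (\<lambda>a. smul a v) -` rays u"
    by (auto simp: phases_def)
  moreover have "closed ((\<lambda>a. smul a v) -` rays u)"
    by (rule closed_vimage [OF closed_rays]) (intro continuous_intros)
  ultimately show ?thesis by (simp add: closed_Int)
qed

lemma phase_function:
  assumes x: "supercyclic_vector x" and proper: "rays x \<noteq> UNIV"
  obtains k :: nat and f :: "'a \<Rightarrow> complex" where "k > 0"
    "\<And>v a. supercyclic_vector v \<Longrightarrow> a \<in> phases x v \<Longrightarrow> f v = a ^ k"
    "continuous_on (Collect supercyclic_vector) f"
proof -
  have "1 \<in> phases x x"
    by (simp add: phases_def rays_self)
  moreover have "phases x x \<noteq> sphere 0 1"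
    using proper rays_eq_UNIV_iff [OF x] by blast
  moreover have "phases x x \<subseteq> sphere 0 1"
    by (auto simp: phases_def)
  ultimately have "\<exists>k>0. \<forall>a\<in>phases x x. a ^ k = 1"
    by (intro proper_closed_subsemigroup_circle closed_phases phases_mult)
  then obtain k where k: "k > 0" "\<And>a. a \<in> phases x x \<Longrightarrow> a ^ k = 1"
    by blast
  define f where "f v = (SOME a. a \<in> phases x v) ^ k" for v
  have f: "f v = a ^ k" if v: "supercyclic_vector v" and a: "a \<in> phases x v" for v a
  proof -
    \<comment> \<open>A phase back from \<open>v\<close> to \<open>x\<close> turns every phase from
      \<open>x\<close> to \<open>v\<close> into one from \<open>x\<close> to itself, where the
      \<open>k\<close>-th power is 1. So all phases to \<open>v\<close> have the same
      \<open>k\<close>-th power.\<close>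
    obtain b where b: "b \<in> phases v x"
      using phases_nonempty [OF v] by blast
    have *: "(c * b) ^ k = 1" if "c \<in> phases x v" for c
      using phases_mult [OF that b] k(2) by blast
    have "(SOME a. a \<in> phases x v) \<in> phases x v"
      using a by (rule someI)
    then have "f v * b ^ k = a ^ k * b ^ k"
      using * [OF a] * unfolding f_def by (metis power_mult_distrib)
    moreover have "b \<noteq> 0" using b by (auto simp: phases_def)
    ultimately show ?thesis by simp
  qed
  have "continuous_on (Collect supercyclic_vector) f"
    unfolding continuous_on_closed_invariant
  proof (intro allI impI)
    fix B :: "complex set" assume "closed B"
    \<comment> \<open>By the previous step, \<open>f v\<close> lies in \<open>B\<close> exactly when
      some phase of \<open>v\<close> lies in the compact set \<open>K\<close>, and this is a closed
      condition on \<open>v\<close>.\<close>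
    define K where "K = sphere 0 1 \<inter> (\<lambda>a. a ^ k) -` B"
    have "compact K"
      unfolding K_def using \<open>closed B\<close>
      by (intro compact_Int_closed compact_sphere closed_vimage continuous_intros)
    then have "closed {v. \<exists>a\<in>K. smul a v \<in> rays x}"
      by (intro closed_scalar_preimage closed_rays)
    moreover have "(\<exists>a\<in>K. smul a v \<in> rays x) \<longleftrightarrow> f v \<in> B" if v: "supercyclic_vector v" for v
    proof
      assume "\<exists>a\<in>K. smul a v \<in> rays x"
      then show "f v \<in> B"
        using f [OF v] by (auto simp: K_def phases_def)
    next
      assume "f v \<in> B"
      moreover obtain a where "a \<in> phases x v"
        using phases_nonempty [OF x] by blast
      ultimately show "\<exists>a\<in>K. smul a v \<in> rays x"
        using f [OF v] by (auto simp: K_def phases_def)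
    qed
    ultimately show "\<exists>A. closed A \<and> A \<inter> Collect supercyclic_vector = f -` B \<inter> Collect supercyclic_vector"
      by (intro exI [of _ "{v. \<exists>a\<in>K. smul a v \<in> rays x}"]) auto
  qed
  with k f that show thesis by blast
qed

section \<open>Density of the rays through an orbit\<close>

lemma rays_eq_UNIV_if_no_eigenvalue:
  assumes x: "supercyclic_vector x"
    and dense: "\<And>\<mu>. closure (range (\<lambda>v. T v - smul \<mu> v)) = UNIV"
  shows "rays x = UNIV"
proof (rule ccontr)
  assume "rays x \<noteq> UNIV"
  then obtain k f where k: "k > 0"
    and f: "\<And>v a. supercyclic_vector v \<Longrightarrow> a \<in> phases x v \<Longrightarrow> f v = a ^ k"
    and cont: "continuous_on (Collect supercyclic_vector) f"
    using phase_function [OF x] by blast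
  \<comment> \<open>The coefficients \<open>w\<close> and \<open>1 - cmod w\<close> never vanish
    together, so each value is a nonzero polynomial in \<open>T\<close> applied to \<open>x\<close>.
    On the circle only \<open>w x\<close> remains, and its phase is
    \<open>inverse w\<close>.\<close>
  define h where "h w = smul w x + smul (1 - of_real (cmod w)) (T x)" for w
  have sv: "supercyclic_vector (h w)" if "w \<in> cball 0 1" for w
  proof -
    define p where "p = [:w, 1 - of_real (cmod w):]"
    have "p \<noteq> 0" by (auto simp: p_def)
    moreover have "h w = peval p x"
      by (simp add: h_def p_def T.zero T.scale)
    ultimately show ?thesis
      using supercyclic_vector_peval [OF x peval_dense_range] dense by simp
  qed
  show False
  proof (rule no_disc_extension_of_inverse_power [of "\<lambda>w. f (h w)" k])
    show "continuous_on (cball 0 1) (\<lambda>w. f (h w))"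
      by (rule continuous_on_compose2 [OF cont]) (use sv in \<open>auto simp: h_def intro!: continuous_intros\<close>)
    show "f (h w) \<noteq> 0" if w: "w \<in> cball 0 1" for w
    proof -
      obtain a where "a \<in> phases x (h w)"
        using phases_nonempty [OF x] by blast
      then show ?thesis using f [OF sv [OF w]] by (auto simp: phases_def)
    qed
    show "f (h w) * w ^ k = 1" if w: "cmod w = 1" for w
    proof -
      have "w \<noteq> 0" using w by auto
      then have "inverse w \<in> phases x (h w)"
        using w by (simp add: phases_def h_def rays_self norm_inverse)
      then show ?thesis
        using f [OF sv] w \<open>w \<noteq> 0\<close> by (simp add: power_mult_distrib [symmetric])
    qed
  qed (rule k)
qed

lemma recurrence_in_neighbourhood:
  assumes x: "supercyclic_vector x" and dense: "closure (range T) = UNIV"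
    and \<phi>: "\<phi> \<in> dual_space smul" "\<And>v. \<phi> (T v) = z * \<phi> v" "\<phi> x \<noteq> 0"
    and U: "open U" "x \<in> U"
  shows "\<exists>n\<ge>N. smul (1 / z ^ n) ((T ^^ n) x) \<in> U"
proof -
  \<comment> \<open>Starting the orbit at this vector makes the final exponent at least
    \<open>N\<close>.\<close>
  have "supercyclic_vector ((T ^^ N) x)"
  proof (induction N)
    case (Suc N)
    have "peval [:0, 1:] = T" by (auto simp: T.zero)
    then show ?case
      using supercyclic_vector_peval [OF Suc, of "[:0, 1:]"] dense by simp
  qed (use x in simp)
  \<comment> \<open>Rescaling to the value \<open>\<phi> x\<close> of \<phi> sends every multiple of
    \<open>(T ^^ m) x\<close> off the kernel of \<phi> to the same point, \<open>1 / z ^ m\<close>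
    times \<open>(T ^^ m) x\<close>, so the arbitrary scalar \<open>s\<close> drops out.\<close>
  define V where "V = {v. \<phi> v \<noteq> 0} \<inter> (\<lambda>v. smul (\<phi> x / \<phi> v) v) -` U"
  have cont: "continuous_on S \<phi>" for S
    using \<phi>(1) continuous_on_subset unfolding dual_space_def by blast
  have "open {v. \<phi> v \<noteq> 0}"
    using open_vimage [OF _ cont, of "- {0}"] by (simp add: vimage_def open_Compl)
  then have "open V"
    unfolding V_def
    by (intro continuous_open_preimage U(1) continuous_intros cont) auto
  moreover have "x \<in> V"
    using U(2) \<phi>(3) by (simp add: V_def)
  ultimately obtain s n where sn: "smul s ((T ^^ n) ((T ^^ N) x)) \<in> V"
    using \<open>supercyclic_vector ((T ^^ N) x)\<close> open_Int_closure_eq_empty [of V]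
    unfolding supercyclic_vector_def by blast
  have "\<phi> (smul s ((T ^^ n) ((T ^^ N) x))) = s * z ^ (n + N) * \<phi> x"
    using dual_eigen_funpow [OF \<phi>(1,2), of "n + N" x]
    by (simp add: funpow_add dual_linear [OF \<phi>(1)])
  moreover have "\<phi> (smul s ((T ^^ n) ((T ^^ N) x))) \<noteq> 0"
    using sn by (simp add: V_def)
  ultimately have "smul (1 / z ^ (n + N)) ((T ^^ (n + N)) x) \<in> U"
    using sn by (simp add: V_def funpow_add)
  then show ?thesis by (intro exI [of _ "n + N"]) simp
qed

text \<open>Polynomials with value 1 at \<open>z\<close> do not have the root \<open>z\<close>, so
  they map \<open>x\<close> to supercyclic vectors. As they form an affine space, \<open>f\<close>
  has a well-defined change of logarithm between any two of them, and this is compared with the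
  recurrence of the orbit.\<close>

lemma rays_eq_UNIV_if_single_eigenvalue:
  assumes x: "supercyclic_vector x"
    and \<phi>: "\<phi> \<in> dual_space smul" "\<And>v. \<phi> (T v) = z * \<phi> v" "\<phi> x \<noteq> 0"
    and z: "z \<noteq> 0" and inf: "\<And>n::nat. n > 0 \<Longrightarrow> sgn z ^ n \<noteq> 1"
    and dense: "\<And>\<mu>. \<mu> \<noteq> z \<Longrightarrow> closure (range (\<lambda>v. T v - smul \<mu> v)) = UNIV"
  shows "rays x = UNIV"
proof (rule ccontr)
  assume "rays x \<noteq> UNIV"
  then obtain k f where k: "k > 0"
    and f: "\<And>v a. supercyclic_vector v \<Longrightarrow> a \<in> phases x v \<Longrightarrow> f v = a ^ k"
    and cont: "continuous_on (Collect supercyclic_vector) f"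
    using phase_function [OF x] by blast
  have f1: "cmod (f v) = 1" if v: "supercyclic_vector v" for v
  proof -
    obtain a where "a \<in> phases x v"
      using phases_nonempty [OF x] by blast
    then show ?thesis using f [OF v] by (auto simp: phases_def norm_power)
  qed
  have fx: "f x = 1"
    using f [OF x, of 1] by (simp add: phases_def rays_self)
  have sv: "supercyclic_vector (peval p x)" if "poly p z = 1" for p
    using that by (intro supercyclic_vector_peval x peval_dense_range dense) auto
  define S where "S p = Polynomial.smult (1/z) (pCons 0 p)" for p
  have poly_S: "poly (S p) z = poly p z" for p
    using z by (simp add: S_def)
  have f_S: "f (peval (S p) x) = sgn z ^ k * f (peval p x)" if p: "poly p z = 1" for p
  proof -
    obtain a where a: "a \<in> phases x (peval p x)"
      using phases_nonempty [OF x] by blast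
    \<comment> \<open>Division by \<open>cmod z\<close> stays inside \<open>rays x\<close>; the
      remaining factor \<open>sgn z\<close> of \<open>z\<close> goes into the phase.\<close>
    have "smul (sgn z * a) (peval (S p) x) = smul (of_real (1 / cmod z)) ((T ^^ 1) (smul a (peval p x)))"
      using z by (simp add: S_def peval_smult T.scale sgn_eq)
    then have "sgn z * a \<in> phases x (peval (S p) x)"
      using a z rays_orbit_of_mem [of "smul a (peval p x)" x "1 / cmod z" 1]
      by (simp add: phases_def norm_mult norm_sgn)
    then have "f (peval (S p) x) = (sgn z * a) ^ k"
      using f sv p poly_S by simp
    also have "\<dots> = sgn z ^ k * f (peval p x)"
      using f [OF sv [OF p] a] by (simp add: power_mult_distrib)
    finally show ?thesis .
  qed
  \<comment> \<open>This is the change of the logarithm of \<open>f\<close> along the segment from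
    p(T) x to q(T) x.\<close>
  define chg where
    "chg p q w \<longleftrightarrow> log_change (\<lambda>t. f (peval (p + Polynomial.smult (of_real t) (q - p)) x)) w" for p q w
  have chg_exists: "\<exists>w. chg p q w" if "poly p z = 1" "poly q z = 1" for p q
    unfolding chg_def
  proof (rule log_change_exists)
    have sv': "supercyclic_vector (peval (p + Polynomial.smult (of_real t) (q - p)) x)" for t :: real
      using that by (intro sv) simp
    show "continuous_on {0..1} (\<lambda>t. f (peval (p + Polynomial.smult (of_real t) (q - p)) x))"
      by (rule continuous_on_compose2 [OF cont])
        (use sv' in \<open>auto simp: peval_add peval_smult intro!: continuous_intros\<close>)
    show "f (peval (p + Polynomial.smult (of_real t) (q - p)) x) \<noteq> 0" for t
      using f1 [OF sv' [of t]] by auto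
  qed
  \<comment> \<open>Along the image segment \<open>f\<close> is only multiplied by the constant
    \<open>sgn z ^ k\<close>.\<close>
  have chg_S: "chg (S p) (S q) w" if "poly p z = 1" "poly q z = 1" "chg p q w" for p q w
  proof -
    have "S p + Polynomial.smult c (S q - S p) = S (p + Polynomial.smult c (q - p))" for c
      by (simp add: S_def smult_add_right smult_diff_right algebra_simps)
    then have "f (peval (S p + Polynomial.smult (of_real t) (S q - S p)) x)
        = sgn z ^ k * f (peval (p + Polynomial.smult (of_real t) (q - p)) x)" for t
      using that by (simp add: f_S)
    then show ?thesis
      using that(3) log_change_scale unfolding chg_def by simp
  qed
  have chg_add: "chg 1 q (u + v)"
    if pq: "poly p z = 1" "poly q z = 1" and u: "chg 1 p u" and v: "chg p q v" for p q u v
  proof -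
    \<comment> \<open>This affine map has the vertices \<open>1\<close>, \<open>p\<close>,
      \<open>q\<close>, and all its values are polynomials with value 1 at \<open>z\<close>.\<close>
    define P where
      "P st = 1 + Polynomial.smult (of_real (fst st)) (p - 1) + Polynomial.smult (of_real (snd st)) (q - 1)"
      for st :: "real \<times> real"
    have sv': "supercyclic_vector (peval (P st) x)" for st
      using pq by (intro sv) (simp add: P_def)
    have "log_change (\<lambda>t. f (peval (P (0, t)) x)) (u + v)"
    proof (rule log_change_triangle)
      show "continuous_on UNIV (\<lambda>st. f (peval (P st) x))"
        by (rule continuous_on_compose2 [OF cont])
          (use sv' in \<open>auto simp: P_def peval_add peval_smult intro!: continuous_intros\<close>)
      show "f (peval (P st) x) \<noteq> 0" for st
        using f1 [OF sv' [of st]] by auto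
      show "log_change (\<lambda>t. f (peval (P (t, 0)) x)) u"
        using u by (simp add: chg_def P_def)
      have "P (1 - t, t) = p + Polynomial.smult (of_real t) (q - p)" for t
        by (simp add: P_def smult_diff_right smult_diff_left one_pCons algebra_simps)
      then show "log_change (\<lambda>t. f (peval (P (1 - t, t)) x)) v"
        using v by (simp add: chg_def)
    qed
    then show ?thesis by (simp add: chg_def P_def)
  qed
  have poly_pow: "poly ((S ^^ n) 1) z = 1" for n
    by (induction n) (simp_all add: poly_S)
  obtain \<alpha> where \<alpha>: "chg 1 (S 1) \<alpha>"
    using chg_exists [of 1 "S 1"] poly_S by auto
  have step: "chg ((S ^^ n) 1) ((S ^^ Suc n) 1) \<alpha>" for n
    by (induction n) (use \<alpha> chg_S poly_pow poly_S in auto)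
  have total: "chg 1 ((S ^^ n) 1) (of_nat n * \<alpha>)" for n
  proof (induction n)
    case 0
    show ?case
      unfolding chg_def log_change_def by (intro exI [of _ "\<lambda>t. 0"]) simp
  next
    case (Suc n)
    show ?case
      using chg_add [OF poly_pow poly_pow Suc step] by (simp add: algebra_simps)
  qed
  have exp_\<alpha>: "sgn z ^ k = exp \<alpha>"
    using log_change_endpoint [OF \<alpha> [unfolded chg_def]] f_S [of 1] fx by simp
  then have "cmod (exp \<alpha>) = 1"
    using z by (metis norm_power norm_sgn power_one)
  then have "Re \<alpha> = 0" by simp
  have near: "\<exists>n\<ge>N. \<bar>Im (of_nat n * \<alpha>)\<bar> < pi / 2" for N
  proof -
    have "open {w. 0 < Re w}"
      by (rule open_halfspace_Re_gt)
    then obtain W where W: "open W"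
      "W \<inter> Collect supercyclic_vector = f -` {w. 0 < Re w} \<inter> Collect supercyclic_vector"
      using cont unfolding continuous_on_open_invariant by blast
    \<comment> \<open>The points whose segment from \<open>x\<close> leaves \<open>W\<close> form a
      closed set not containing \<open>x\<close>. Recurrence thus yields \<open>n\<close> for which
      \<open>f\<close> has positive real part on the whole segment, which bounds the change of
      argument.\<close>
    have "closed {v. \<exists>t\<in>{0..1::real}. x + smul (of_real t) (v - x) \<in> - W}"
      using closed_projection_compact
        [of "{0..1::real}" "\<lambda>p. x + smul (of_real (fst p)) (snd p - x)" "- W"] W(1)
      by (simp add: continuous_intros closed_Compl)
    moreover have "x \<in> W"
      using W(2) x fx by auto
    ultimately obtain n where n: "n \<ge> N"
      "smul (1 / z ^ n) ((T ^^ n) x) \<in> - {v. \<exists>t\<in>{0..1::real}. x + smul (of_real t) (v - x) \<in> - W}"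
      using recurrence_in_neighbourhood
        [OF x _ \<phi>, of "- {v. \<exists>t\<in>{0..1::real}. x + smul (of_real t) (v - x) \<in> - W}" N] dense [of 0] z
      by (auto simp: open_Compl)
    define p where "p = (S ^^ n) 1"
    have "peval ((S ^^ n) 1) x = smul (1 / z ^ n) ((T ^^ n) x)"
      by (induction n) (simp_all add: S_def peval_smult T.scale)
    then have inW: "peval (1 + Polynomial.smult (of_real t) (p - 1)) x \<in> W" if "t \<in> {0..1}" for t :: real
      using n(2) that by (auto simp: p_def peval_add peval_smult peval_diff)
    have "\<bar>Im (of_nat n * \<alpha>)\<bar> < pi / 2"
    proof (rule log_change_halfplane)
      show "log_change (\<lambda>t. f (peval (1 + Polynomial.smult (of_real t) (p - 1)) x)) (of_nat n * \<alpha>)"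
        using total [of n] by (simp add: chg_def p_def)
      show "0 < Re (f (peval (1 + Polynomial.smult (of_real t) (p - 1)) x))" if t: "t \<in> {0..1}" for t :: real
        using inW [OF t] W(2) sv [of "1 + Polynomial.smult (of_real t) (p - 1)"] poly_pow
        by (auto simp: p_def)
    qed (simp add: fx)
    with n(1) show ?thesis by blast
  qed
  \<comment> \<open>The change \<open>n * Im \<alpha>\<close> is below \<open>pi / 2\<close> in
    modulus for arbitrarily large \<open>n\<close>.\<close>
  have "Im \<alpha> = 0"
  proof (rule ccontr)
    assume "Im \<alpha> \<noteq> 0"
    then obtain N :: nat where N: "pi / 2 < N * \<bar>Im \<alpha>\<bar>"
      using reals_Archimedean3 by (metis zero_less_abs_iff)
    obtain n where n: "n \<ge> N" "\<bar>Im (of_nat n * \<alpha>)\<bar> < pi / 2"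
      using near by blast
    have "real N * \<bar>Im \<alpha>\<bar> \<le> real n * \<bar>Im \<alpha>\<bar>"
      using n(1) by (intro mult_right_mono) auto
    with n(2) N show False by (simp add: abs_mult)
  qed
  with \<open>Re \<alpha> = 0\<close> have "\<alpha> = 0"
    by (simp add: complex_eq_iff)
  then show False
    using exp_\<alpha> inf [OF k] by simp
qed

section \<open>Eigenvalues of the dual operator\<close>

lemma dual_point_spectrumE:
  assumes "z \<in> dual_point_spectrum smul T"
  obtains \<phi> where "\<phi> \<in> dual_space smul" "\<And>v. \<phi> (T v) = z * \<phi> v" "\<exists>v. \<phi> v \<noteq> 0"
  using assms unfolding dual_point_spectrum_def dual_operator_def by (auto simp: fun_eq_iff)

text \<open>An eigenfunctional vanishing at \<open>x\<close> would vanish on the scaled orbit and,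
  by continuity, everywhere.\<close>

lemma dual_nonzero_at_supercyclic_vector:
  assumes x: "supercyclic_vector x"
    and \<phi>: "\<phi> \<in> dual_space smul" "\<And>v. \<phi> (T v) = z * \<phi> v" "\<phi> u \<noteq> 0"
  shows "\<phi> x \<noteq> 0"
proof
  assume "\<phi> x = 0"
  then have "\<phi> (smul s ((T ^^ n) x)) = 0" for s n
    by (simp add: dual_linear [OF \<phi>(1)] dual_eigen_funpow [OF \<phi>(1,2)])
  then have "\<phi> ` closure {smul s ((T ^^ n) x) | s n. True} \<subseteq> {0}"
    using \<phi>(1) by (intro image_closure_subset) (auto simp: dual_space_def intro: continuous_on_subset)
  with x \<phi>(3) show False unfolding supercyclic_vector_def by blast
qed

text \<open>
  If \<open>|a| \<le> |b|\<close>, then \<open>|\<phi>| / |\<psi>|\<close> does not increase along the orbit, which by density bounds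
  \<open>|\<phi>|\<close> by a multiple of \<open>|\<psi>|\<close>.
\<close>

lemma eigenvalue_unique:
  assumes x: "supercyclic_vector x"
    and z: "z \<in> dual_point_spectrum smul T" and w: "w \<in> dual_point_spectrum smul T"
  shows "z = w"
proof -
  have "a = b" if ab: "a \<in> dual_point_spectrum smul T" "b \<in> dual_point_spectrum smul T"
    "cmod a \<le> cmod b" for a b
  proof (rule ccontr)
    assume "a \<noteq> b"
    obtain \<phi> where \<phi>: "\<phi> \<in> dual_space smul" "\<And>v. \<phi> (T v) = a * \<phi> v" "\<exists>v. \<phi> v \<noteq> 0"
      using dual_point_spectrumE [OF ab(1)] by metis
    obtain \<psi> where \<psi>: "\<psi> \<in> dual_space smul" "\<And>v. \<psi> (T v) = b * \<psi> v" "\<exists>v. \<psi> v \<noteq> 0"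
      using dual_point_spectrumE [OF ab(2)] by metis
    have \<psi>x: "\<psi> x \<noteq> 0"
      using dual_nonzero_at_supercyclic_vector [OF x \<psi>(1,2)] \<psi>(3) by blast
    have le: "cmod (\<phi> (smul s ((T ^^ n) x))) * cmod (\<psi> x) \<le> cmod (\<psi> (smul s ((T ^^ n) x))) * cmod (\<phi> x)" for s n
    proof -
      have "cmod a ^ n * (cmod s * cmod (\<phi> x) * cmod (\<psi> x)) \<le> cmod b ^ n * (cmod s * cmod (\<phi> x) * cmod (\<psi> x))"
        using ab(3) by (intro mult_right_mono power_mono) auto
      then show ?thesis
        by (simp add: dual_linear [OF \<phi>(1)] dual_linear [OF \<psi>(1)] dual_eigen_funpow [OF \<phi>(1,2)]
            dual_eigen_funpow [OF \<psi>(1,2)] norm_mult norm_power mult_ac)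
    qed
    have "closed {v. cmod (\<phi> v) * cmod (\<psi> x) \<le> cmod (\<psi> v) * cmod (\<phi> x)}"
      using \<phi>(1) \<psi>(1) by (intro closed_Collect_le continuous_intros) (auto simp: dual_space_def)
    then have "closure {smul s ((T ^^ n) x) | s n. True}
        \<subseteq> {v. cmod (\<phi> v) * cmod (\<psi> x) \<le> cmod (\<psi> v) * cmod (\<phi> x)}"
      by (rule closure_minimal [rotated]) (use le in blast)
    then have all: "cmod (\<phi> v) * cmod (\<psi> x) \<le> cmod (\<psi> v) * cmod (\<phi> x)" for v
      using x unfolding supercyclic_vector_def by blast
    obtain v where v: "\<phi> v \<noteq> 0" using \<phi>(3) by blast
    \<comment> \<open>This vector is annihilated by \<psi>, but \<phi> is nonzero on it when
      \<open>a\<close> and \<open>b\<close> differ, which contradicts the bound.\<close>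
    have "\<psi> (T v - smul b v) = 0" "\<phi> (T v - smul b v) = (a - b) * \<phi> v"
      by (simp_all add: dual_linear [OF \<phi>(1)] dual_linear [OF \<psi>(1)] \<phi>(2) \<psi>(2) algebra_simps)
    then have "cmod ((a - b) * \<phi> v) * cmod (\<psi> x) \<le> 0"
      using all [of "T v - smul b v"] by simp
    then show False
      using \<open>a \<noteq> b\<close> v \<psi>x by (simp add: norm_mult mult_le_0_iff)
  qed
  then show ?thesis
    using z w linear [of "cmod z" "cmod w"] by metis
qed

lemma supercyclic_vector_if_rays:
  assumes "rays x = UNIV"
  shows "supercyclic_vector x"
proof -
  have "rays x \<subseteq> closure {smul s ((T ^^ n) x) | s n. True}"
    unfolding rays_def by (rule closure_mono) blast
  with assms show ?thesis
    by (simp add: supercyclic_vector_def top.extremum_uniqueI)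
qed

text \<open>On the generators of \<open>rays x\<close> the quotient
  \<open>\<phi> v / \<phi> x\<close> equals \<open>s * z ^ n\<close>, whose \<open>N\<close>-th
  power would be a nonnegative real. By continuity this would hold on the whole space, although
  \<phi> takes every value.\<close>

lemma eigenvalue_power_not_nonneg_real:
  assumes x: "rays x = UNIV" and z: "z \<in> dual_point_spectrum smul T" and N: "N > 0"
  shows "z ^ N \<notin> \<real>\<^sub>\<ge>\<^sub>0"
proof
  assume pos: "z ^ N \<in> \<real>\<^sub>\<ge>\<^sub>0"
  obtain \<phi> where \<phi>: "\<phi> \<in> dual_space smul" "\<And>v. \<phi> (T v) = z * \<phi> v" "\<exists>v. \<phi> v \<noteq> 0"
    using dual_point_spectrumE [OF z] by metis
  obtain u where u: "\<phi> u \<noteq> 0" using \<phi>(3) by blast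
  have "supercyclic_vector x"
    using x by (rule supercyclic_vector_if_rays)
  then have \<phi>x: "\<phi> x \<noteq> 0"
    using dual_nonzero_at_supercyclic_vector \<phi>(1,2) u by blast
  have "(\<lambda>v. (\<phi> v / \<phi> x) ^ N) ` rays x \<subseteq> \<real>\<^sub>\<ge>\<^sub>0"
    unfolding rays_def
  proof (rule image_closure_subset)
    show "(\<lambda>v. (\<phi> v / \<phi> x) ^ N) ` {smul (of_real s) ((T ^^ n) x) | s n. 0 \<le> s} \<subseteq> \<real>\<^sub>\<ge>\<^sub>0"
    proof clarify
      fix s :: real and n assume s: "0 \<le> s"
      have "(\<phi> (smul (of_real s) ((T ^^ n) x)) / \<phi> x) ^ N = of_real (s ^ N) * (z ^ N) ^ n"
        using \<phi>x
        by (simp add: dual_linear [OF \<phi>(1)] dual_eigen_funpow [OF \<phi>(1,2)] power_mult_distrib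
            power_mult [symmetric] mult.commute)
      moreover have "(z ^ N) ^ n \<in> \<real>\<^sub>\<ge>\<^sub>0"
        using pos by (induction n) (auto intro: nonneg_Reals_mult_I)
      ultimately show "(\<phi> (smul (of_real s) ((T ^^ n) x)) / \<phi> x) ^ N \<in> \<real>\<^sub>\<ge>\<^sub>0"
        using s by (auto intro!: nonneg_Reals_mult_I simp del: of_real_power)
    qed
    show "closed (\<real>\<^sub>\<ge>\<^sub>0 :: complex set)" by (rule closed_nonneg_Reals_complex)
  qed (use \<phi>(1) in \<open>auto simp: dual_space_def divide_inverse intro!: continuous_intros intro: continuous_on_subset\<close>)
  \<comment> \<open>At this vector the quotient is \<open>cis (pi / N)\<close>, whose
    \<open>N\<close>-th power is -1.\<close>
  moreover define v where "v = smul (\<phi> x * cis (pi / N) / \<phi> u) u"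
  ultimately have "(\<phi> v / \<phi> x) ^ N \<in> \<real>\<^sub>\<ge>\<^sub>0"
    using x by blast
  then have "cis (pi / N) ^ N \<in> \<real>\<^sub>\<ge>\<^sub>0"
    using u \<phi>x by (simp add: v_def dual_linear [OF \<phi>(1)])
  then show False
    using N by (simp add: Complex.DeMoivre)
qed

end

section \<open>The characterization of R_+-supercyclicity by supercyclicity and the point
  spectrum\<close>

theorem theorem1p3:
  fixes smul :: "complex \<Rightarrow> 'a \<Rightarrow> 'a :: {topological_ab_group_add, t2_space}"
    and T :: "'a \<Rightarrow> 'a"
  assumes "complex_tvs smul"
    and "infinite_dimensional smul"
    and "Vector_Spaces.linear smul smul T"
    and "continuous_on UNIV T"
  shows "Rplus_supercyclic smul T \<longleftrightarrow>
    supercyclic smul T \<and>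
    (dual_point_spectrum smul T = {} \<or>
     (\<exists>z. dual_point_spectrum smul T = {z} \<and> z \<noteq> 0 \<and>
          infinite_order_in_circle (z / complex_of_real (cmod z))))"
proof -
  interpret continuous_operator smul T
    using assms by (simp add: continuous_operator_def continuous_operator_axioms_def)
  have Rplus: "Rplus_supercyclic smul T \<longleftrightarrow> (\<exists>x. rays x = UNIV)"
    by (simp add: Rplus_supercyclic_def rays_def)
  have super: "supercyclic smul T \<longleftrightarrow> (\<exists>x. supercyclic_vector x)"
    by (simp add: supercyclic_def supercyclic_vector_def)
  show ?thesis
  proof
    assume "Rplus_supercyclic smul T"
    then obtain x where x: "rays x = UNIV"
      using Rplus by blast
    then have sx: "supercyclic_vector x"
      by (rule supercyclic_vector_if_rays)
    have inf: "z \<noteq> 0 \<and> infinite_order_in_circle (z / of_real (cmod z))"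
      if z: "z \<in> dual_point_spectrum smul T" for z
    proof
      \<comment> \<open>Exponent 1 excludes \<open>z = 0\<close>, and if \<open>z / cmod z\<close>
        had finite order \<open>n\<close>, then \<open>z ^ n\<close> would be the positive real
        \<open>cmod z ^ n\<close>.\<close>
      note nn = eigenvalue_power_not_nonneg_real [OF x z]
      show "z \<noteq> 0" using nn [of 1] by auto
      moreover have "(z / of_real (cmod z)) ^ n \<noteq> 1" if "n > 0" for n
      proof
        assume "(z / of_real (cmod z)) ^ n = 1"
        then have "z ^ n = of_real (cmod z ^ n)"
          using \<open>z \<noteq> 0\<close> by (simp add: power_divide)
        then show False
          using nn [OF that] by (simp del: of_real_power)
      qed
      ultimately show "infinite_order_in_circle (z / of_real (cmod z))"
        by (simp add: infinite_order_in_circle_iff norm_divide)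
    qed
    have "dual_point_spectrum smul T = {z}" if "z \<in> dual_point_spectrum smul T" for z
      using eigenvalue_unique [OF sx] that by blast
    with inf sx super show "supercyclic smul T \<and>
      (dual_point_spectrum smul T = {} \<or>
       (\<exists>z. dual_point_spectrum smul T = {z} \<and> z \<noteq> 0 \<and>
          infinite_order_in_circle (z / complex_of_real (cmod z))))"
      by blast
  next
    assume *: "supercyclic smul T \<and>
      (dual_point_spectrum smul T = {} \<or>
       (\<exists>z. dual_point_spectrum smul T = {z} \<and> z \<noteq> 0 \<and>
          infinite_order_in_circle (z / complex_of_real (cmod z))))"
    then obtain x where x: "supercyclic_vector x"
      using super by blast
    from * consider "dual_point_spectrum smul T = {}" |
      z where "dual_point_spectrum smul T = {z}" "z \<noteq> 0" "infinite_order_in_circle (z / of_real (cmod z))"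
      by blast
    then have "rays x = UNIV"
    proof cases
      case 1
      then show ?thesis
        using dense_range_if_not_eigenvalue [OF x] by (intro rays_eq_UNIV_if_no_eigenvalue x) blast
    next
      case 2
      obtain \<phi> where \<phi>: "\<phi> \<in> dual_space smul" "\<And>v. \<phi> (T v) = z * \<phi> v" "\<exists>v. \<phi> v \<noteq> 0"
        using dual_point_spectrumE [of z] 2(1) by (metis singletonI)
      show ?thesis
      proof (rule rays_eq_UNIV_if_single_eigenvalue [OF x \<phi>(1,2)])
        show "\<phi> x \<noteq> 0"
          using dual_nonzero_at_supercyclic_vector [OF x \<phi>(1,2)] \<phi>(3) by blast
        show "sgn z ^ n \<noteq> 1" if "n > 0" for n
          using 2(3) that by (simp add: infinite_order_in_circle_iff sgn_eq)
        show "closure (range (\<lambda>v. T v - smul \<mu> v)) = UNIV" if "\<mu> \<noteq> z" for \<mu>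
          using dense_range_if_not_eigenvalue [OF x] 2(1) that by blast
      qed (rule 2(2))
    qed
    then show "Rplus_supercyclic smul T"
      using Rplus by blast
  qed
qed

end
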